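(* Let $X$ and $Y$ be topological spaces. For a function $f:X\to Y$, the following are equivalent: (1) $f$ is weakly $eR$-continuous; (2) for all $x\in X$ and every open set $V$ of $Y$ containing $f(x)$, there exists an $e$-$\theta$-open set $U$ in $X$ containing $x$ such that $f[U]\subseteq cl(V)$; (3) $e\text{-}cl_{\theta}(f^{-1}[U])\subseteq f^{-1}[cl(U)]$ for every preopen set $U$ of $Y$; (4) $f^{-1}[U]\subseteq e\text{-}int_{\theta}(f^{-1}[cl(U)])$ for every preopen set $U$ of $Y$; (5) $e\text{-}cl_{\theta}(f^{-1}[int(cl(B))])\subseteq f^{-1}[cl(B)]$ for every subset $B$ of $Y$; (6) $e\text{-}cl_{\theta}(f^{-1}[int(F)])\subseteq f^{-1}[F]$ for every regular closed set $F$ of $Y$; (7) $e\text{-}cl_{\theta}(f^{-1}[U])\subseteq f^{-1}[cl(U)]$ for every open subset $U$ of $Y$; (8) $f^{-1}[U]\subseteq e\text{-}int_{\theta}(f^{-1}[cl(U)])$ for every open subset $U$ of $Y$; (9) $f[e\text{-}cl_\theta(A)]\subseteq cl_{\theta}(f[A])$ for every subset $A$ of $X$; (10) $e\text{-}cl_{\theta}(f^{-1}[B])\subseteq f^{-1}[cl_\theta(B)]$ for every subset $B$ of $Y$; (11) $e\text{-}cl_{\theta}(f^{-1}[int(cl_\theta(B))])\subseteq f^{-1}[cl_\theta(B)]$ for every subset $B$ of $Y$.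
   Context: For a subset $A$ of a topological space $X$, $cl(A)$ and $int(A)$ denote closure and interior. $A$ is preopen if $A\subseteq int(cl(A))$, and regular closed if $A=cl(int(A))$. The $\delta$-closure $cl_\delta(A)$ is the set of all $x\in X$ such that $int(cl(U))\cap A\neq\emptyset$ for every open set $U$ containing $x$; the $\delta$-interior $int_\delta(A)$ is the set of all $x$ for which there is an open $U$ containing $x$ with $int(cl(U))\subseteq A$. $A$ is $e$-open if $A\subseteq cl(int_\delta(A))\cup int(cl_\delta(A))$; $A$ is $e$-closed if its complement is $e$-open; $A$ is $e$-regular if it is both $e$-open and $e$-closed. The $e$-closure $e\text{-}cl(A)$ is the intersection of all $e$-closed sets containing $A$. The $\theta$-closure $cl_\theta(A)$ is the set of all $x$ such that $cl(U)\cap A\neq\emptyset$ for every open set $U$ containing $x$. The $e$-$\theta$-closure $e\text{-}cl_\theta(A)$ is the set of all $x$ such that $e\text{-}cl(U)\cap A\neq\emptyset$ for every $e$-open set $U$ containing $x$. $A$ is $e$-$\theta$-closed if $A=e\text{-}cl_\theta(A)$, and $e$-$\theta$-open if its complement is $e$-$\theta$-closed. The $e$-$\theta$-interior $e\text{-}int_\theta(A)$ is the set of all $x$ for which there is an $e$-open set $U$ containing $x$ with $e\text{-}cl(U)\subseteq A$. A function $f:X\to Y$ is weakly $eR$-continuous if for every $x\in X$ and every open set $V$ of $Y$ containing $f(x)$ there exists an $e$-regular set $U$ in $X$ containing $x$ with $f[U]\subseteq cl(V)$. *)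

theory Defs
  imports "HOL-Analysis.Analysis"
begin

text \<open>
  A space is a value of type \<open>'a topology\<close>, so the carrier \<open>topspace X\<close> may be any set, including
  the empty one; complements are taken relative to it. The predicates on sets below imply that the
  set lies in the carrier, either by the shape of the condition (\<open>X closure_of _\<close> and
  \<open>X interior_of _\<close> are subsets of \<open>topspace X\<close>) or by an explicit conjunct.
\<close>

definition preopenin :: "'a topology \<Rightarrow> 'a set \<Rightarrow> bool" where
  "preopenin X A \<longleftrightarrow> A \<subseteq> X interior_of (X closure_of A)"

definition regular_closedin :: "'a topology \<Rightarrow> 'a set \<Rightarrow> bool" where
  "regular_closedin X A \<longleftrightarrow> A = X closure_of (X interior_of A)"

definition delta_closure_of :: "'a topology \<Rightarrow> 'a set \<Rightarrow> 'a set" (infixr \<open>delta'_closure'_of\<close> 80) where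
  "X delta_closure_of A =
     {x \<in> topspace X. \<forall>U. openin X U \<and> x \<in> U \<longrightarrow> X interior_of (X closure_of U) \<inter> A \<noteq> {}}"

definition delta_interior_of :: "'a topology \<Rightarrow> 'a set \<Rightarrow> 'a set" (infixr \<open>delta'_interior'_of\<close> 80) where
  "X delta_interior_of A =
     {x. \<exists>U. openin X U \<and> x \<in> U \<and> X interior_of (X closure_of U) \<subseteq> A}"

definition theta_closure_of :: "'a topology \<Rightarrow> 'a set \<Rightarrow> 'a set" (infixr \<open>theta'_closure'_of\<close> 80) where
  "X theta_closure_of A =
     {x \<in> topspace X. \<forall>U. openin X U \<and> x \<in> U \<longrightarrow> X closure_of U \<inter> A \<noteq> {}}"

definition e_openin :: "'a topology \<Rightarrow> 'a set \<Rightarrow> bool" where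
  "e_openin X A \<longleftrightarrow>
     A \<subseteq> X closure_of (X delta_interior_of A) \<union> X interior_of (X delta_closure_of A)"

definition e_closedin :: "'a topology \<Rightarrow> 'a set \<Rightarrow> bool" where
  "e_closedin X A \<longleftrightarrow> A \<subseteq> topspace X \<and> e_openin X (topspace X - A)"

definition e_regularin :: "'a topology \<Rightarrow> 'a set \<Rightarrow> bool" where
  "e_regularin X A \<longleftrightarrow> e_openin X A \<and> e_closedin X A"

text \<open>Meaningful for \<open>A \<subseteq> topspace X\<close>; otherwise the intersection is over the empty family.\<close>

definition e_closure_of :: "'a topology \<Rightarrow> 'a set \<Rightarrow> 'a set" (infixr \<open>e'_closure'_of\<close> 80) where
  "X e_closure_of A = \<Inter>{C. e_closedin X C \<and> A \<subseteq> C}"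

definition e_theta_closure_of :: "'a topology \<Rightarrow> 'a set \<Rightarrow> 'a set" (infixr \<open>e'_theta'_closure'_of\<close> 80) where
  "X e_theta_closure_of A =
     {x \<in> topspace X. \<forall>U. e_openin X U \<and> x \<in> U \<longrightarrow> X e_closure_of U \<inter> A \<noteq> {}}"

definition e_theta_interior_of :: "'a topology \<Rightarrow> 'a set \<Rightarrow> 'a set" (infixr \<open>e'_theta'_interior'_of\<close> 80) where
  "X e_theta_interior_of A =
     {x. \<exists>U. e_openin X U \<and> x \<in> U \<and> X e_closure_of U \<subseteq> A}"

definition e_theta_closedin :: "'a topology \<Rightarrow> 'a set \<Rightarrow> bool" where
  "e_theta_closedin X A \<longleftrightarrow> A = X e_theta_closure_of A"

definition e_theta_openin :: "'a topology \<Rightarrow> 'a set \<Rightarrow> bool" where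
  "e_theta_openin X A \<longleftrightarrow> A \<subseteq> topspace X \<and> e_theta_closedin X (topspace X - A)"

definition weakly_eR_continuous_map :: "'a topology \<Rightarrow> 'b topology \<Rightarrow> ('a \<Rightarrow> 'b) \<Rightarrow> bool" where
  "weakly_eR_continuous_map X Y f \<longleftrightarrow>
     f \<in> topspace X \<rightarrow> topspace Y \<and>
     (\<forall>x \<in> topspace X. \<forall>V. openin Y V \<and> f x \<in> V \<longrightarrow>
        (\<exists>U. e_regularin X U \<and> x \<in> U \<and> f ` U \<subseteq> Y closure_of V))"

end

theory Submission
  imports Defs
begin

text \<open>
  The key point is that the \<open>e\<close>-closure of an \<open>e\<close>-open set is \<open>e\<close>-regular: it is contained in
  \<open>A \<union> int (cl\<^sub>\<delta> A)\<close>, because that set is already \<open>e\<close>-closed. Hence the \<open>e\<close>-\<open>\<theta>\<close>-closure and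
  \<open>e\<close>-\<open>\<theta>\<close>-interior are the closure and interior operators generated by the \<open>e\<close>-regular sets, and
  the \<open>e\<close>-\<open>\<theta>\<close>-open sets are the unions of \<open>e\<close>-regular sets. What remains is bookkeeping in \<open>Y\<close>:
  closure and \<open>\<theta>\<close>-closure agree on open sets, and \<open>cl U\<close> is regular closed for preopen \<open>U\<close>.
\<close>

section \<open>Closures of open and preopen sets\<close>

lemma subset_interior_of_closure_of: "openin X U \<Longrightarrow> U \<subseteq> X interior_of (X closure_of U)"
  by (simp add: closure_of_subset interior_of_maximal openin_subset)

lemma openin_imp_preopenin: "openin X U \<Longrightarrow> preopenin X U"
  by (simp add: preopenin_def subset_interior_of_closure_of)

lemma closure_of_interior_of_closure_of_subset:
  "X closure_of (X interior_of (X closure_of A)) \<subseteq> X closure_of A"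
  by (simp add: closure_of_minimal interior_of_subset)

text \<open>Taking closures in the preopenness inclusion puts \<open>X closure_of U\<close> inside
  the closure of its interior; the converse inclusion holds for every set.\<close>

lemma regular_closedin_closure_of_preopenin:
  assumes "preopenin X U" shows "regular_closedin X (X closure_of U)"
  using assms closure_of_mono closure_of_interior_of_closure_of_subset
  unfolding preopenin_def regular_closedin_def by (metis subset_antisym)

section \<open>The theta-closure\<close>

lemma theta_closure_of_subset_topspace: "X theta_closure_of A \<subseteq> topspace X"
  by (auto simp: theta_closure_of_def)

lemma theta_closure_of_mono: "A \<subseteq> B \<Longrightarrow> X theta_closure_of A \<subseteq> X theta_closure_of B"
  unfolding theta_closure_of_def by blast

text \<open>An open \<open>U\<close> meets \<open>X closure_of V\<close> exactly when it meets
  \<open>V\<close>, so both closures impose the same test on neighbourhoods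
  \<open>V\<close>.\<close>

lemma theta_closure_of_openin:
  assumes "openin X U" shows "X theta_closure_of U = X closure_of U"
proof
  show "X theta_closure_of U \<subseteq> X closure_of U"
  proof
    fix x assume x: "x \<in> X theta_closure_of U"
    have "V \<inter> U \<noteq> {}" if "openin X V" "x \<in> V" for V
      using x that assms openin_Int_closure_of_eq_empty[OF assms, of V]
      unfolding theta_closure_of_def by blast
    then show "x \<in> X closure_of U"
      using x unfolding theta_closure_of_def in_closure_of by blast
  qed
  show "X closure_of U \<subseteq> X theta_closure_of U"
  proof
    fix x assume x: "x \<in> X closure_of U"
    have "X closure_of V \<inter> U \<noteq> {}" if "openin X V" "x \<in> V" for V
      using x that closure_of_subset[OF openin_subset[OF that(1)]]
      unfolding in_closure_of by blast
    then show "x \<in> X theta_closure_of U"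
      using x unfolding theta_closure_of_def in_closure_of by blast
  qed
qed

text \<open>A neighbourhood \<open>U\<close> whose closure misses \<open>A\<close> excludes all of
  its own points at once, so the complement is open.\<close>

lemma closedin_theta_closure_of: "closedin X (X theta_closure_of A)"
proof -
  have "openin X (topspace X - X theta_closure_of A)"
  proof (subst openin_subopen, intro ballI)
    fix x assume "x \<in> topspace X - X theta_closure_of A"
    then obtain U where U: "openin X U" "x \<in> U" "X closure_of U \<inter> A = {}"
      unfolding theta_closure_of_def by blast
    then have "U \<subseteq> topspace X - X theta_closure_of A"
      using openin_subset unfolding theta_closure_of_def by blast
    with U show "\<exists>T. openin X T \<and> x \<in> T \<and> T \<subseteq> topspace X - X theta_closure_of A"
      by blast
  qed
  then show ?thesis
    by (simp add: closedin_def theta_closure_of_subset_topspace)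
qed

section \<open>The delta-closure and delta-interior\<close>

lemma delta_closure_of_mono: "A \<subseteq> B \<Longrightarrow> X delta_closure_of A \<subseteq> X delta_closure_of B"
  unfolding delta_closure_of_def by blast

lemma delta_interior_of_mono: "A \<subseteq> B \<Longrightarrow> X delta_interior_of A \<subseteq> X delta_interior_of B"
  unfolding delta_interior_of_def by blast

lemma delta_interior_of_subset: "X delta_interior_of A \<subseteq> A"
  unfolding delta_interior_of_def using subset_interior_of_closure_of[of X] by blast

text \<open>The set \<open>?R\<close> is open, and the interior of its closure is no larger than
  \<open>?R\<close>. So \<open>?R\<close> serves as a witness at each of its own points, not only at
  \<open>x\<close>.\<close>

lemma delta_interior_of_idem:
  "X delta_interior_of (X delta_interior_of A) = X delta_interior_of A"
proof
  show "X delta_interior_of A \<subseteq> X delta_interior_of (X delta_interior_of A)"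
  proof
    fix x assume "x \<in> X delta_interior_of A"
    then obtain U where U: "openin X U" "x \<in> U" "X interior_of (X closure_of U) \<subseteq> A"
      unfolding delta_interior_of_def by blast
    let ?R = "X interior_of (X closure_of U)"
    have "X interior_of (X closure_of ?R) \<subseteq> A"
      using interior_of_mono[OF closure_of_interior_of_closure_of_subset] U(3) by (rule order_trans)
    then have "?R \<subseteq> X delta_interior_of A"
      unfolding delta_interior_of_def using openin_interior_of by blast
    with U show "x \<in> X delta_interior_of (X delta_interior_of A)"
      unfolding delta_interior_of_def[of X "X delta_interior_of A"] by blast
  qed
qed (rule delta_interior_of_subset)

text \<open>This duality turns the delta-closure in the e-openness condition into a delta-interior
  of a complement, which is what e-closedness asks about.\<close>

lemma delta_interior_of_complement:
  "X delta_interior_of (topspace X - A) = topspace X - X delta_closure_of A"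
proof -
  have "(X interior_of S \<subseteq> topspace X - A) \<longleftrightarrow> (X interior_of S \<inter> A = {})" for S
    using interior_of_subset_topspace[of X S] by blast
  then show ?thesis
    unfolding delta_interior_of_def delta_closure_of_def using openin_subset[of X] by blast
qed

section \<open>e-open and e-closed sets, and the e-closure\<close>

lemma e_openin_subset: "e_openin X A \<Longrightarrow> A \<subseteq> topspace X"
  unfolding e_openin_def
  by (meson Un_least closure_of_subset_topspace interior_of_subset_topspace order_trans)

text \<open>Two facts rest on this monotonicity: unions of e-open sets are e-open, and so is the
  e-closure of an e-open set.\<close>

lemma e_openin_bound_mono:
  assumes "A \<subseteq> B"
  shows "X closure_of (X delta_interior_of A) \<union> X interior_of (X delta_closure_of A)
    \<subseteq> X closure_of (X delta_interior_of B) \<union> X interior_of (X delta_closure_of B)"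
  using assms by (intro Un_mono closure_of_mono interior_of_mono delta_interior_of_mono
      delta_closure_of_mono)

lemma e_openin_Union:
  assumes "\<And>A. A \<in> \<A> \<Longrightarrow> e_openin X A" shows "e_openin X (\<Union>\<A>)"
  using assms e_openin_bound_mono[of _ "\<Union>\<A>" X] unfolding e_openin_def
  by (meson Sup_least Sup_upper order_trans)

lemma e_regularin_subset: "e_regularin X A \<Longrightarrow> A \<subseteq> topspace X"
  unfolding e_regularin_def e_closedin_def by simp

text \<open>The complement \<open>?D\<close> contains \<open>?W\<close>, and \<open>?W\<close> is
  its own delta-interior, so \<open>?W\<close> lies in the delta-interior of \<open>?D\<close>. The
  closure of \<open>?W\<close> is the complement of
  \<open>X interior_of (X delta_closure_of A)\<close> and hence covers \<open>?D\<close>: the first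
  half of the e-openness bound suffices.\<close>

lemma e_closedin_Un_interior_of_delta_closure_of:
  assumes "A \<subseteq> topspace X"
  shows "e_closedin X (A \<union> X interior_of (X delta_closure_of A))"
proof -
  let ?D = "topspace X - (A \<union> X interior_of (X delta_closure_of A))"
  let ?W = "topspace X - X delta_closure_of A"
  have "?W \<subseteq> topspace X - A"
    using delta_interior_of_complement delta_interior_of_subset by metis
  moreover have "X interior_of (X delta_closure_of A) \<subseteq> X delta_closure_of A"
    by (rule interior_of_subset)
  ultimately have "?W \<subseteq> ?D" by blast
  then have "?W \<subseteq> X delta_interior_of ?D"
    using delta_interior_of_mono delta_interior_of_idem delta_interior_of_complement by metis
  then have "X closure_of ?W \<subseteq> X closure_of (X delta_interior_of ?D)"
    by (rule closure_of_mono)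
  moreover have "?D \<subseteq> X closure_of ?W"
    by (auto simp: closure_of_complement)
  ultimately show ?thesis
    using assms interior_of_subset_topspace[of X "X delta_closure_of A"]
    unfolding e_closedin_def e_openin_def by blast
qed

lemma e_closure_of_subset: "A \<subseteq> X e_closure_of A"
  unfolding e_closure_of_def by blast

lemma e_closure_of_minimal: "e_closedin X C \<Longrightarrow> A \<subseteq> C \<Longrightarrow> X e_closure_of A \<subseteq> C"
  unfolding e_closure_of_def by blast

lemma e_closure_of_e_closedin: "e_closedin X C \<Longrightarrow> X e_closure_of C = C"
  by (simp add: e_closure_of_minimal e_closure_of_subset subset_antisym)

lemma e_closedin_e_closure_of:
  assumes "A \<subseteq> topspace X" shows "e_closedin X (X e_closure_of A)"
proof -
  let ?\<C> = "{C. e_closedin X C \<and> A \<subseteq> C}"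
  \<comment> \<open>The intersection of an empty family would be \<open>UNIV\<close>; a member is
    needed to keep the e-closure inside the carrier.\<close>
  have ne: "?\<C> \<noteq> {}"
    using e_closedin_Un_interior_of_delta_closure_of[OF assms] by blast
  have "topspace X - X e_closure_of A = \<Union>((\<lambda>C. topspace X - C) ` ?\<C>)"
    unfolding e_closure_of_def by blast
  moreover have "e_openin X (\<Union>((\<lambda>C. topspace X - C) ` ?\<C>))"
    by (rule e_openin_Union) (auto simp: e_closedin_def)
  moreover have "X e_closure_of A \<subseteq> topspace X"
    using ne unfolding e_closure_of_def e_closedin_def by blast
  ultimately show ?thesis
    unfolding e_closedin_def by simp
qed

text \<open>The points added to \<open>A\<close> lie in the interior of its delta-closure, the
  second half of the e-openness bound for \<open>A\<close>. Enlarging \<open>A\<close> to its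
  e-closure only enlarges that bound.\<close>

lemma e_regularin_e_closure_of:
  assumes "e_openin X A" shows "e_regularin X (X e_closure_of A)"
proof -
  have sub: "A \<subseteq> topspace X" using assms by (rule e_openin_subset)
  have "X e_closure_of A \<subseteq> A \<union> X interior_of (X delta_closure_of A)"
    by (intro e_closure_of_minimal e_closedin_Un_interior_of_delta_closure_of sub) simp
  also have "\<dots> \<subseteq> X closure_of (X delta_interior_of A) \<union> X interior_of (X delta_closure_of A)"
    using assms unfolding e_openin_def by blast
  also have "\<dots> \<subseteq> X closure_of (X delta_interior_of (X e_closure_of A))
      \<union> X interior_of (X delta_closure_of (X e_closure_of A))"
    by (intro e_openin_bound_mono e_closure_of_subset)
  finally show ?thesis
    using e_closedin_e_closure_of[OF sub] unfolding e_regularin_def e_openin_def by simp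
qed

section \<open>The e-theta-interior, e-theta-closure and e-theta-open sets\<close>

lemma e_theta_interior_of_iff:
  "x \<in> X e_theta_interior_of A \<longleftrightarrow> (\<exists>U. e_regularin X U \<and> x \<in> U \<and> U \<subseteq> A)"
proof
  assume "x \<in> X e_theta_interior_of A"
  then obtain U where "e_openin X U" "x \<in> U" "X e_closure_of U \<subseteq> A"
    unfolding e_theta_interior_of_def by blast
  \<comment> \<open>The e-regular witness is the e-closure of \<open>U\<close>.\<close>
  then show "\<exists>U. e_regularin X U \<and> x \<in> U \<and> U \<subseteq> A"
    using e_regularin_e_closure_of[of X U] e_closure_of_subset[of U X] by blast
next
  assume "\<exists>U. e_regularin X U \<and> x \<in> U \<and> U \<subseteq> A"
  then obtain U where "e_openin X U" "X e_closure_of U = U" "x \<in> U" "U \<subseteq> A"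
    unfolding e_regularin_def using e_closure_of_e_closedin[of X] by blast
  then show "x \<in> X e_theta_interior_of A"
    unfolding e_theta_interior_of_def by auto
qed

text \<open>The e-closure of an e-open set stays in the carrier, so its inclusion in the complement
  amounts to disjointness from \<open>A\<close>.\<close>

lemma e_theta_interior_of_complement:
  assumes "A \<subseteq> topspace X"
  shows "X e_theta_interior_of (topspace X - A) = topspace X - X e_theta_closure_of A"
proof -
  have "(X e_closure_of U \<subseteq> topspace X - A) \<longleftrightarrow> (X e_closure_of U \<inter> A = {})"
    if "e_openin X U" for U
    using e_closedin_e_closure_of[OF e_openin_subset[OF that]] unfolding e_closedin_def by blast
  moreover have "x \<in> topspace X" if "e_openin X U" "x \<in> U" for x U
    using that e_openin_subset by blast
  ultimately show ?thesis
    unfolding e_theta_interior_of_def e_theta_closure_of_def by blast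
qed

text \<open>An e-regular set is e-open and equals its own e-closure, so it can be used directly as a
  test set.\<close>

lemma e_theta_closure_of_meets:
  assumes "x \<in> X e_theta_closure_of A" "e_regularin X U" "x \<in> U"
  shows "U \<inter> A \<noteq> {}"
  using assms e_closure_of_e_closedin[of X U]
  unfolding e_theta_closure_of_def e_regularin_def by auto

lemma e_theta_closure_of_subset_topspace: "X e_theta_closure_of A \<subseteq> topspace X"
  by (auto simp: e_theta_closure_of_def)

lemma e_theta_closure_of_mono: "A \<subseteq> B \<Longrightarrow> X e_theta_closure_of A \<subseteq> X e_theta_closure_of B"
  unfolding e_theta_closure_of_def by blast

lemma e_theta_interior_of_mono: "A \<subseteq> B \<Longrightarrow> X e_theta_interior_of A \<subseteq> X e_theta_interior_of B"
  unfolding e_theta_interior_of_def by blast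

lemma e_theta_openin_eq_interior:
  "e_theta_openin X A \<longleftrightarrow> A = X e_theta_interior_of A"
proof -
  have sub: "X e_theta_interior_of A \<subseteq> topspace X"
    using e_regularin_subset[of X] by (meson e_theta_interior_of_iff subsetD subsetI)
  show ?thesis
  proof (cases "A \<subseteq> topspace X")
    case True
    then have "X e_theta_interior_of A = topspace X - X e_theta_closure_of (topspace X - A)"
      using e_theta_interior_of_complement[of "topspace X - A" X] by (simp add: double_diff)
    moreover have "X e_theta_closure_of (topspace X - A) \<subseteq> topspace X"
      by (rule e_theta_closure_of_subset_topspace)
    ultimately show ?thesis
      using True unfolding e_theta_openin_def e_theta_closedin_def by blast
  next
    \<comment> \<open>Neither side can hold here, since the e-theta-interior stays in the
      carrier.\<close>
    case False
    then show ?thesis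
      using sub unfolding e_theta_openin_def by auto
  qed
qed

lemma e_theta_openin_iff:
  "e_theta_openin X A \<longleftrightarrow> (\<forall>x\<in>A. \<exists>U. e_regularin X U \<and> x \<in> U \<and> U \<subseteq> A)"
  unfolding e_theta_openin_eq_interior
  by (auto simp: set_eq_iff e_theta_interior_of_iff)

lemma e_regularin_imp_e_theta_openin: "e_regularin X A \<Longrightarrow> e_theta_openin X A"
  by (auto simp: e_theta_openin_iff)

section \<open>Equivalent forms of weak eR-continuity\<close>

theorem theorem3p9:
  fixes X :: "'a topology" and Y :: "'b topology" and f :: "'a \<Rightarrow> 'b"
  assumes "f \<in> topspace X \<rightarrow> topspace Y"
  shows
    "(weakly_eR_continuous_map X Y f \<longleftrightarrow>
       (\<forall>x \<in> topspace X. \<forall>V. openin Y V \<and> f x \<in> V \<longrightarrow>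
          (\<exists>U. e_theta_openin X U \<and> x \<in> U \<and> f ` U \<subseteq> Y closure_of V))) \<and>
     (weakly_eR_continuous_map X Y f \<longleftrightarrow>
       (\<forall>U. preopenin Y U \<longrightarrow>
          X e_theta_closure_of {x \<in> topspace X. f x \<in> U}
          \<subseteq> {x \<in> topspace X. f x \<in> Y closure_of U})) \<and>
     (weakly_eR_continuous_map X Y f \<longleftrightarrow>
       (\<forall>U. preopenin Y U \<longrightarrow>
          {x \<in> topspace X. f x \<in> U}
          \<subseteq> X e_theta_interior_of {x \<in> topspace X. f x \<in> Y closure_of U})) \<and>
     (weakly_eR_continuous_map X Y f \<longleftrightarrow>
       (\<forall>B. B \<subseteq> topspace Y \<longrightarrow>
          X e_theta_closure_of {x \<in> topspace X. f x \<in> Y interior_of (Y closure_of B)}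
          \<subseteq> {x \<in> topspace X. f x \<in> Y closure_of B})) \<and>
     (weakly_eR_continuous_map X Y f \<longleftrightarrow>
       (\<forall>F. regular_closedin Y F \<longrightarrow>
          X e_theta_closure_of {x \<in> topspace X. f x \<in> Y interior_of F}
          \<subseteq> {x \<in> topspace X. f x \<in> F})) \<and>
     (weakly_eR_continuous_map X Y f \<longleftrightarrow>
       (\<forall>U. openin Y U \<longrightarrow>
          X e_theta_closure_of {x \<in> topspace X. f x \<in> U}
          \<subseteq> {x \<in> topspace X. f x \<in> Y closure_of U})) \<and>
     (weakly_eR_continuous_map X Y f \<longleftrightarrow>
       (\<forall>U. openin Y U \<longrightarrow>
          {x \<in> topspace X. f x \<in> U}
          \<subseteq> X e_theta_interior_of {x \<in> topspace X. f x \<in> Y closure_of U})) \<and>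
     (weakly_eR_continuous_map X Y f \<longleftrightarrow>
       (\<forall>A. A \<subseteq> topspace X \<longrightarrow>
          f ` (X e_theta_closure_of A)
          \<subseteq> Y theta_closure_of (f ` A))) \<and>
     (weakly_eR_continuous_map X Y f \<longleftrightarrow>
       (\<forall>B. B \<subseteq> topspace Y \<longrightarrow>
          X e_theta_closure_of {x \<in> topspace X. f x \<in> B}
          \<subseteq> {x \<in> topspace X. f x \<in> Y theta_closure_of B})) \<and>
     (weakly_eR_continuous_map X Y f \<longleftrightarrow>
       (\<forall>B. B \<subseteq> topspace Y \<longrightarrow>
          X e_theta_closure_of {x \<in> topspace X. f x \<in> Y interior_of (Y theta_closure_of B)}
          \<subseteq> {x \<in> topspace X. f x \<in> Y theta_closure_of B}))"
proof -
  let ?pre = "\<lambda>S. {x \<in> topspace X. f x \<in> S}"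
  let ?P2 = "\<forall>x \<in> topspace X. \<forall>V. openin Y V \<and> f x \<in> V \<longrightarrow>
    (\<exists>U. e_theta_openin X U \<and> x \<in> U \<and> f ` U \<subseteq> Y closure_of V)"
  let ?P3 = "\<forall>U. preopenin Y U \<longrightarrow> X e_theta_closure_of ?pre U \<subseteq> ?pre (Y closure_of U)"
  let ?P4 = "\<forall>U. preopenin Y U \<longrightarrow> ?pre U \<subseteq> X e_theta_interior_of ?pre (Y closure_of U)"
  let ?P5 = "\<forall>B. B \<subseteq> topspace Y \<longrightarrow>
    X e_theta_closure_of ?pre (Y interior_of (Y closure_of B)) \<subseteq> ?pre (Y closure_of B)"
  let ?P6 = "\<forall>F. regular_closedin Y F \<longrightarrow> X e_theta_closure_of ?pre (Y interior_of F) \<subseteq> ?pre F"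
  let ?P7 = "\<forall>U. openin Y U \<longrightarrow> X e_theta_closure_of ?pre U \<subseteq> ?pre (Y closure_of U)"
  let ?P8 = "\<forall>U. openin Y U \<longrightarrow> ?pre U \<subseteq> X e_theta_interior_of ?pre (Y closure_of U)"
  let ?P9 = "\<forall>A. A \<subseteq> topspace X \<longrightarrow> f ` (X e_theta_closure_of A) \<subseteq> Y theta_closure_of (f ` A)"
  let ?P10 = "\<forall>B. B \<subseteq> topspace Y \<longrightarrow> X e_theta_closure_of ?pre B \<subseteq> ?pre (Y theta_closure_of B)"
  let ?P11 = "\<forall>B. B \<subseteq> topspace Y \<longrightarrow>
    X e_theta_closure_of ?pre (Y interior_of (Y theta_closure_of B)) \<subseteq> ?pre (Y theta_closure_of B)"
  have fX: "f x \<in> topspace Y" if "x \<in> topspace X" for x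
    using assms that by blast
  have P1: "weakly_eR_continuous_map X Y f \<longleftrightarrow>
      (\<forall>x \<in> topspace X. \<forall>V. openin Y V \<and> f x \<in> V \<longrightarrow>
        (\<exists>U. e_regularin X U \<and> x \<in> U \<and> f ` U \<subseteq> Y closure_of V))" (is "?P1 \<longleftrightarrow> _")
    using assms unfolding weakly_eR_continuous_map_def by simp

  have eq2: "?P1 \<longleftrightarrow> ?P2"
  proof
    show ?P2 if ?P1
      using that e_regularin_imp_e_theta_openin unfolding P1 by blast
    show ?P1 if ?P2
      unfolding P1
    proof (intro ballI allI impI)
      fix x V assume "x \<in> topspace X" and "openin Y V \<and> f x \<in> V"
      then obtain W where W: "e_theta_openin X W" "x \<in> W" "f ` W \<subseteq> Y closure_of V"
        using \<open>?P2\<close> by blast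
      \<comment> \<open>An e-theta-open set is a union of e-regular sets, so \<open>W\<close> can be
        shrunk around \<open>x\<close>.\<close>
      then obtain U where "e_regularin X U" "x \<in> U" "U \<subseteq> W"
        unfolding e_theta_openin_iff by blast
      with W show "\<exists>U. e_regularin X U \<and> x \<in> U \<and> f ` U \<subseteq> Y closure_of V"
        by blast
    qed
  qed

  (* The label ij or ijk stands for the implication (i) ==> (j), e.g. 117 is (11) ==> (7). *)
  have 19: ?P9 if ?P1
  proof (intro allI impI subsetI)
    fix A y assume "y \<in> f ` (X e_theta_closure_of A)"
    then obtain x where x: "x \<in> X e_theta_closure_of A" "y = f x" by blast
    then have xX: "x \<in> topspace X" using e_theta_closure_of_subset_topspace[of X A] by blast
    have "Y closure_of V \<inter> f ` A \<noteq> {}" if V: "openin Y V" "f x \<in> V" for V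
    proof -
      obtain U where "e_regularin X U" "x \<in> U" "f ` U \<subseteq> Y closure_of V"
        using \<open>?P1\<close> xX V unfolding P1 by blast
      moreover from this x have "U \<inter> A \<noteq> {}"
        by (intro e_theta_closure_of_meets) simp_all
      ultimately show ?thesis by blast
    qed
    then show "y \<in> Y theta_closure_of (f ` A)"
      using fX[OF xX] x(2) unfolding theta_closure_of_def by blast
  qed

  have 910: ?P10 if ?P9
  proof (intro allI impI)
    fix B
    \<comment> \<open>\<open>?P9\<close> is used for the preimage of \<open>B\<close>, whose image
      falls back into \<open>B\<close>.\<close>
    have "f ` (X e_theta_closure_of ?pre B) \<subseteq> Y theta_closure_of (f ` ?pre B)"
      using that by (simp add: Collect_restrict)
    also have "\<dots> \<subseteq> Y theta_closure_of B"
      by (rule theta_closure_of_mono) blast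
    finally show "X e_theta_closure_of ?pre B \<subseteq> ?pre (Y theta_closure_of B)"
      using e_theta_closure_of_subset_topspace[of X "?pre B"] by blast
  qed

  have 1011: ?P11 if ?P10
  proof (intro allI impI)
    fix B
    let ?I = "Y interior_of (Y theta_closure_of B)"
    \<comment> \<open>As \<open>?I\<close> is open, its theta-closure is its closure, and the closed
      set \<open>Y theta_closure_of B\<close> containing \<open>?I\<close> contains that
      closure.\<close>
    have "Y theta_closure_of ?I \<subseteq> Y theta_closure_of B"
      by (simp add: theta_closure_of_openin closure_of_minimal interior_of_subset
          closedin_theta_closure_of)
    moreover have "X e_theta_closure_of ?pre ?I \<subseteq> ?pre (Y theta_closure_of ?I)"
      using that interior_of_subset_topspace[of Y "Y theta_closure_of B"] by simp
    ultimately show "X e_theta_closure_of ?pre ?I \<subseteq> ?pre (Y theta_closure_of B)"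
      by blast
  qed

  have 117: ?P7 if ?P11
  proof (intro allI impI)
    fix U assume U: "openin Y U"
    have "U \<subseteq> Y interior_of (Y theta_closure_of U)"
      using U by (simp add: theta_closure_of_openin subset_interior_of_closure_of)
    then have "X e_theta_closure_of ?pre U
        \<subseteq> X e_theta_closure_of ?pre (Y interior_of (Y theta_closure_of U))"
      by (intro e_theta_closure_of_mono) blast
    also have "\<dots> \<subseteq> ?pre (Y theta_closure_of U)"
      using that openin_subset[OF U] by simp
    finally show "X e_theta_closure_of ?pre U \<subseteq> ?pre (Y closure_of U)"
      using U by (simp add: theta_closure_of_openin)
  qed

  have 78: ?P8 if ?P7
  proof (intro allI impI)
    fix U assume U: "openin Y U"
    \<comment> \<open>\<open>?P7\<close> is applied to the exterior of \<open>U\<close>;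
      complementing its conclusion in \<open>X\<close> then bounds an e-theta-interior from
      below.\<close>
    let ?V = "topspace Y - Y closure_of U"
    have "openin Y ?V" by (simp add: openin_diff)
    then have "X e_theta_closure_of ?pre ?V \<subseteq> ?pre (Y closure_of ?V)"
      by (rule that[rule_format])
    \<comment> \<open>The closure of \<open>?V\<close> is the complement of
      \<open>Y interior_of (Y closure_of U)\<close>, which contains \<open>U\<close>.\<close>
    also have "\<dots> \<subseteq> topspace X - ?pre U"
      using subset_interior_of_closure_of[OF U] by (auto simp: closure_of_complement)
    finally have "?pre U \<subseteq> topspace X - X e_theta_closure_of ?pre ?V"
      by blast
    also have "\<dots> = X e_theta_interior_of (topspace X - ?pre ?V)"
      by (rule e_theta_interior_of_complement[symmetric]) blast
    \<comment> \<open>Because \<open>f\<close> maps into \<open>topspace Y\<close>, a value outside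
      \<open>?V\<close> must lie in \<open>Y closure_of U\<close>.\<close>
    also have "topspace X - ?pre ?V = ?pre (Y closure_of U)"
      using fX by blast
    finally show "?pre U \<subseteq> X e_theta_interior_of ?pre (Y closure_of U)" .
  qed

  have 81: ?P1 if ?P8
    unfolding P1
  proof (intro ballI allI impI)
    fix x V assume "x \<in> topspace X" and "openin Y V \<and> f x \<in> V"
    then have "x \<in> X e_theta_interior_of ?pre (Y closure_of V)"
      using that by blast
    then show "\<exists>U. e_regularin X U \<and> x \<in> U \<and> f ` U \<subseteq> Y closure_of V"
      unfolding e_theta_interior_of_iff by blast
  qed

  have 84: ?P4 if ?P8
  proof (intro allI impI)
    fix U assume U: "preopenin Y U"
    \<comment> \<open>Preopenness places \<open>U\<close> inside the open set \<open>?I\<close>,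
      whose closure is still within that of \<open>U\<close>; so \<open>?P8\<close> for
      \<open>?I\<close> suffices.\<close>
    let ?I = "Y interior_of (Y closure_of U)"
    have "?pre U \<subseteq> ?pre ?I"
      using U unfolding preopenin_def by blast
    also have "\<dots> \<subseteq> X e_theta_interior_of ?pre (Y closure_of ?I)"
      using that by simp
    also have "\<dots> \<subseteq> X e_theta_interior_of ?pre (Y closure_of U)"
      using closure_of_interior_of_closure_of_subset[of Y U]
      by (intro e_theta_interior_of_mono) blast
    finally show "?pre U \<subseteq> X e_theta_interior_of ?pre (Y closure_of U)" .
  qed

  have 48: ?P8 if ?P4
    using that by (simp add: openin_imp_preopenin)

  have 75: ?P5 if ?P7
  proof (intro allI impI)
    fix B
    have "X e_theta_closure_of ?pre (Y interior_of (Y closure_of B))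
        \<subseteq> ?pre (Y closure_of (Y interior_of (Y closure_of B)))"
      using that by simp
    then show "X e_theta_closure_of ?pre (Y interior_of (Y closure_of B)) \<subseteq> ?pre (Y closure_of B)"
      using closure_of_interior_of_closure_of_subset[of Y B] by blast
  qed

  have 56: ?P6 if ?P5
  proof (intro allI impI)
    fix F assume "regular_closedin Y F"
    \<comment> \<open>Being a closure, \<open>F\<close> is closed, so \<open>?P5\<close> with
      \<open>B = F\<close> has \<open>F\<close> in place of \<open>Y closure_of B\<close> on both
      sides.\<close>
    then have "closedin Y F"
      unfolding regular_closedin_def by (metis closedin_closure_of)
    then have "F \<subseteq> topspace Y" "Y closure_of F = F"
      by (simp_all add: closedin_subset closure_of_closedin)
    with that[rule_format, of F] show "X e_theta_closure_of ?pre (Y interior_of F) \<subseteq> ?pre F"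
      by simp
  qed

  have 63: ?P3 if ?P6
  proof (intro allI impI)
    fix U assume U: "preopenin Y U"
    then have "X e_theta_closure_of ?pre U
        \<subseteq> X e_theta_closure_of ?pre (Y interior_of (Y closure_of U))"
      unfolding preopenin_def by (intro e_theta_closure_of_mono) blast
    also have "\<dots> \<subseteq> ?pre (Y closure_of U)"
      using that regular_closedin_closure_of_preopenin[OF U] by simp
    finally show "X e_theta_closure_of ?pre U \<subseteq> ?pre (Y closure_of U)" .
  qed

  have 37: ?P7 if ?P3
    using that by (simp add: openin_imp_preopenin)

  \<comment> \<open>The implications form the main cycle \<open>?P1\<close>, \<open>?P9\<close>,
    \<open>?P10\<close>, \<open>?P11\<close>, \<open>?P7\<close>, \<open>?P8\<close>,
    \<open>?P1\<close>, with a loop \<open>?P7\<close>, \<open>?P5\<close>, \<open>?P6\<close>,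
    \<open>?P3\<close>, \<open>?P7\<close> and a loop \<open>?P8\<close>, \<open>?P4\<close>,
    \<open>?P8\<close> attached.\<close>
  note 17 = 117[OF 1011[OF 910[OF 19]]] and 71 = 81[OF 78]
  note 73 = 63[OF 56[OF 75]]
  have eq3: "?P1 \<longleftrightarrow> ?P3"
    by (rule iffI) (fact 73[OF 17], fact 71[OF 37])
  have eq4: "?P1 \<longleftrightarrow> ?P4"
    by (rule iffI) (fact 84[OF 78[OF 17]], fact 81[OF 48])
  have eq5: "?P1 \<longleftrightarrow> ?P5"
    by (rule iffI) (fact 75[OF 17], fact 71[OF 37[OF 63[OF 56]]])
  have eq6: "?P1 \<longleftrightarrow> ?P6"
    by (rule iffI) (fact 56[OF 75[OF 17]], fact 71[OF 37[OF 63]])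
  have eq7: "?P1 \<longleftrightarrow> ?P7"
    by (rule iffI) (fact 17, fact 71)
  have eq8: "?P1 \<longleftrightarrow> ?P8"
    by (rule iffI) (fact 78[OF 17], fact 81)
  have eq9: "?P1 \<longleftrightarrow> ?P9"
    by (rule iffI) (fact 19, fact 71[OF 117[OF 1011[OF 910]]])
  have eq10: "?P1 \<longleftrightarrow> ?P10"
    by (rule iffI) (fact 910[OF 19], fact 71[OF 117[OF 1011]])
  have eq11: "?P1 \<longleftrightarrow> ?P11"
    by (rule iffI) (fact 1011[OF 910[OF 19]], fact 71[OF 117])
  show ?thesis
    by (intro conjI eq2 eq3 eq4 eq5 eq6 eq7 eq8 eq9 eq10 eq11)
qed

end
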